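(* Let $P$ be a Laurent polynomial in $x_1,\ldots,x_r$ with integer coefficients and $p$ a prime, and suppose there exists $n\in\mathbb{N}$ with $\mathrm{ct}(P^n)\equiv0\pmod p$. Then for every Laurent polynomial $Q$ with integer coefficients, the set of indices $n\in\mathbb{N}$ with $\mathrm{ct}(P^nQ)\equiv 0\pmod p$ has density $1$ (i.e. the frequency of $0$ in $(\mathrm{ct}(P^nQ)\bmod p)_{n}$ is $1$). In particular, $(\mathrm{ct}(P^nQ)\bmod p)_n$ contains arbitrarily long runs of $0$s and is not uniformly recurrent.
   Context: $\mathrm{ct}(Q)$ denotes the constant term of a Laurent polynomial $Q$. A sequence $(s_n)$ is uniformly recurrent if for every finite word $w$ occurring in it there is $C_w$ such that every occurrence of $w$ is followed by another occurrence starting at distance at most $C_w$. Density of a set $S\subseteq\mathbb{N}$ means $\lim_{N\to\infty}|S\cap[0,N)|/N$.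
   Formalization: The claim "is not uniformly recurrent" is stated only when ct(P^nQ) is not ≡ 0 mod p for all n; otherwise (e.g. Q = 0) the sequence is constantly 0 and hence uniformly recurrent. *)

theory Defs
  imports
    "HOL-Analysis.Finite_Cartesian_Product"
    "HOL-Library.Poly_Mapping"
    "HOL-Number_Theory.Cong"
begin

text \<open>
  A Laurent polynomial in variables indexed by the finite type \<open>'r\<close> is a finitely supported
  function from exponent vectors in \<open>int ^ 'r\<close> to integers. The convolution product of
  \<open>\<Rightarrow>\<^sub>0\<close> with respect to vector addition is the product of Laurent polynomials.
\<close>

type_synonym 'r laurent_poly = "(int ^ 'r) \<Rightarrow>\<^sub>0 int"

definition ct :: "('r::finite) laurent_poly \<Rightarrow> int" where
  "ct Q = Poly_Mapping.lookup Q 0"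

definition has_density :: "nat set \<Rightarrow> real \<Rightarrow> bool" where
  "has_density S d \<longleftrightarrow> (\<lambda>N. real (card (S \<inter> {0..<N})) / real N) \<longlonglongrightarrow> d"

definition occurs_at :: "(nat \<Rightarrow> 'a) \<Rightarrow> 'a list \<Rightarrow> nat \<Rightarrow> bool" where
  "occurs_at s w i \<longleftrightarrow> (\<forall>j<length w. s (i + j) = w ! j)"

definition uniformly_recurrent :: "(nat \<Rightarrow> 'a) \<Rightarrow> bool" where
  "uniformly_recurrent s \<longleftrightarrow>
     (\<forall>w. (\<exists>i. occurs_at s w i) \<longrightarrow>
       (\<exists>C. \<forall>i. occurs_at s w i \<longrightarrow> (\<exists>j. i < j \<and> j \<le> i + C \<and> occurs_at s w j)))"

definition has_arbitrarily_long_runs :: "(nat \<Rightarrow> 'a) \<Rightarrow> 'a \<Rightarrow> bool" where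
  "has_arbitrarily_long_runs s a \<longleftrightarrow> (\<forall>L. \<exists>i. occurs_at s (replicate L a) i)"

end

theory Submission
  imports Defs "HOL-Number_Theory.Residues"
begin

text \<open>
  Let \<open>\<Lambda>\<^sub>q\<close> be the Cartier operator, which keeps the exponents divisible by \<open>q\<close> and divides
  them by \<open>q\<close>. For \<open>q\<close> a power of \<open>p\<close>, the Frobenius congruence \<open>A(x)\<^sup>q \<equiv> A(x\<^sup>q)\<close> gives
  \<open>ct (A\<^sup>q R) \<equiv> ct (A \<Lambda>\<^sub>q R)\<close> modulo \<open>p\<close>, so reading base-\<open>p\<close> digits of \<open>n\<close> from the
  least significant end transforms \<open>Q\<close> into some \<open>\<Lambda>\<^sub>q (P\<^sup>v Q)\<close> of bounded degree. Reading
  sufficiently many zeros collapses such a polynomial to its constant term; reading the digits of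
  \<open>n\<^sub>0\<close>, where \<open>ct (P ^ n\<^sub>0) \<equiv> 0\<close>, and once more many zeros then collapses it to a multiple of
  \<open>ct (P ^ n\<^sub>0)\<close>, that is, to \<open>0\<close>. Hence the coefficient vanishes for every \<open>n\<close> whose expansion
  contains one fixed block of digits, and almost all \<open>n\<close> have this property.
\<close>

section \<open>The Cartier operator\<close>

text \<open>A pullback of the coefficient function along \<open>v\<close> to \<open>q v\<close>. The
  lookup rule of \<open>map_key\<close> needs this map to be injective, hence the assumption
  \<open>q > 0\<close> below.\<close>

definition cartier :: "nat \<Rightarrow> ('r::finite) laurent_poly \<Rightarrow> 'r laurent_poly" where
  "cartier q = Poly_Mapping.map_key (\<lambda>v. int q *s v)"

lemma lookup_cartier:
  assumes "q > 0"
  shows "Poly_Mapping.lookup (cartier q R) v = Poly_Mapping.lookup R (int q *s v)"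
proof -
  have "inj (\<lambda>v. int q *s v)"
    using assms by (auto intro!: injI simp: vec_eq_iff)
  then show ?thesis
    unfolding cartier_def by (subst map_key.rep_eq) simp_all
qed

lemma cartier_cartier:
  assumes "q > 0" "q' > 0"
  shows "cartier q (cartier q' R) = cartier (q' * q) R"
  using assms by (intro poly_mapping_eqI) (simp add: lookup_cartier vector_smult_assoc)

lemma cartier_1 [simp]: "cartier (Suc 0) R = R"
  by (intro poly_mapping_eqI) (simp add: lookup_cartier)

lemma lookup_single_mult:
  fixes R :: "'a::ab_group_add \<Rightarrow>\<^sub>0 'b::comm_semiring_1"
  shows "Poly_Mapping.lookup (Poly_Mapping.single u c * R) k = c * Poly_Mapping.lookup R (k - u)"
proof -
  have "Sum_any (\<lambda>q. Poly_Mapping.lookup R q when k = u + q)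
      = Sum_any (\<lambda>q. Poly_Mapping.lookup R q when q = k - u)"
    by (rule arg_cong[where f = Sum_any]) (auto simp: fun_eq_iff when_def algebra_simps)
  also have "\<dots> = Poly_Mapping.lookup R (k - u)" by (rule Sum_any_when_equal)
  finally show ?thesis
    by (simp add: lookup_mult lookup_single when_mult)
qed

section \<open>Constant terms and the Frobenius congruence\<close>

lemma ct_add: "ct (A + B) = ct A + ct B"
  by (simp add: ct_def lookup_add)

lemma ct_single_mult:
  "ct (Poly_Mapping.single u c * R) = c * Poly_Mapping.lookup R (- u)"
  by (simp add: ct_def lookup_single_mult)

lemma ct_mult_const: "ct (A * Poly_Mapping.single 0 c) = ct A * c"
  by (subst mult.commute) (simp add: ct_single_mult, simp add: ct_def)

lemma ct_of_nat_mult: "ct (of_nat m * R) = int m * ct R"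
  by (metis ct_mult_const mult.commute single_of_nat)

text \<open>The inner binomial coefficients are divisible by \<open>p\<close>. The multiple of
  \<open>p\<close> stays explicit because coefficients are never reduced; \<open>ct\<close> later
  turns it into a multiple of \<open>p\<close>.\<close>

lemma freshman_remainder:
  fixes a b :: "'a::comm_ring_1"
  assumes "prime p"
  obtains T where "(a + b) ^ p = a ^ p + b ^ p + of_nat p * T"
proof -
  have p: "p > 1" using assms prime_gt_1_nat by simp
  define t where "t k = of_nat (p choose k) * a ^ k * b ^ (p - k)" for k
  have "of_nat p dvd (\<Sum>k\<in>{0<..<p}. t k)"
  proof (rule dvd_sum)
    fix k assume "k \<in> {0<..<p}"
    then have "p dvd (p choose k)"
      using assms by (intro dvd_choose_prime) auto
    then have "of_nat p dvd (of_nat (p choose k) :: 'a)"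
      by (metis dvdE dvd_triv_left of_nat_mult)
    then show "of_nat p dvd t k" by (simp add: t_def mult.assoc)
  qed
  then obtain T where T: "(\<Sum>k\<in>{0<..<p}. t k) = of_nat p * T" by (elim dvdE)
  have "{..p} = insert 0 (insert p {0<..<p})" using p by auto
  then have "(a + b) ^ p = t 0 + (t p + (\<Sum>k\<in>{0<..<p}. t k))"
    using p by (simp add: binomial_ring t_def)
  then have "(a + b) ^ p = a ^ p + b ^ p + of_nat p * T"
    unfolding T using p by (simp add: t_def add_ac)
  then show thesis by (rule that)
qed

lemma fermat_int:
  assumes "prime p"
  shows "[c ^ p = c] (mod int p)"
proof (cases "int p dvd c")
  case True
  then have "int p dvd c ^ p"
    using assms by (meson dvd_power_same dvd_trans dvd_power prime_gt_0_nat)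
  then show ?thesis using True by (simp add: cong_0_iff cong_def mod_eq_0_iff_dvd)
next
  case False
  define a where "a = nat (c mod int p)"
  have p: "p > 0" using assms prime_gt_0_nat by simp
  then have a: "int a = c mod int p" by (simp add: a_def)
  have "\<not> p dvd a"
    using False p a by (metis dvd_mod_iff dvd_refl int_dvd_int_iff)
  then have "[a ^ (p - 1) * a = 1 * a] (mod p)"
    using assms by (intro cong_mult fermat_theorem) auto
  then have "[a ^ p = a] (mod p)" using p by (simp flip: power_Suc2)
  then have "[int a ^ p = int a] (mod int p)"
    by (metis cong_int_iff of_nat_power)
  moreover have "[c = int a] (mod int p)" by (simp add: a cong_def)
  ultimately show ?thesis by (meson cong_pow cong_sym cong_trans)
qed

lemma single_power:
  "Poly_Mapping.single v c ^ n = Poly_Mapping.single (int n *s v) (c ^ n)"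
  by (induction n)
    (simp_all add: mult_single vector_sadd_rdistrib flip: single_one)

text \<open>Modulo \<open>p\<close> both sides are additive in \<open>A\<close>, so monomials
  suffice. For a monomial with exponent \<open>v\<close>, both sides read the coefficient of
  \<open>R\<close> at \<open>- p v\<close>, and Fermat replaces \<open>c ^ p\<close> by
  \<open>c\<close>.\<close>

lemma ct_power_prime_mult:
  assumes "prime p"
  shows "[ct (A ^ p * R) = ct (A * cartier p R)] (mod int p)"
proof (induction A rule: update_induct)
  case const
  then show ?case using prime_gt_0_nat[OF assms] by (simp add: ct_def power_0_left)
next
  case (update A v c)
  let ?M = "Poly_Mapping.single v c"
  \<comment> \<open>Here \<open>v\<close> is not yet a key of \<open>A\<close>, so updating is the
    same as adding a monomial.\<close>
  have upd: "Poly_Mapping.update v c A = A + ?M"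
    using update(1)
    by (intro poly_mapping_eqI)
      (auto simp: lookup_update lookup_add lookup_single when_def in_keys_iff)
  have minus: "- (int p *s v) = int p *s (- v)" by (simp add: vec_eq_iff)
  have M: "[ct (?M ^ p * R) = ct (?M * cartier p R)] (mod int p)"
    unfolding single_power ct_single_mult lookup_cartier[OF prime_gt_0_nat[OF assms]] minus
    by (intro cong_mult fermat_int assms cong_refl)
  obtain T where T: "(A + ?M) ^ p = A ^ p + ?M ^ p + of_nat p * T"
    using freshman_remainder[OF assms] .
  have "(A + ?M) ^ p * R = A ^ p * R + ?M ^ p * R + of_nat p * (T * R)"
    by (simp add: T distrib_right mult.assoc)
  then have "[ct ((A + ?M) ^ p * R) = ct (A ^ p * R) + ct (?M ^ p * R)] (mod int p)"
    by (simp add: ct_add ct_of_nat_mult cong_def)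
  also have "[ct (A ^ p * R) + ct (?M ^ p * R)
      = ct (A * cartier p R) + ct (?M * cartier p R)] (mod int p)"
    by (intro cong_add update(3) M)
  finally show ?case by (simp add: upd distrib_right ct_add)
qed

lemma ct_prime_power_mult:
  assumes "prime p"
  shows "[ct (A ^ (p ^ e) * R) = ct (A * cartier (p ^ e) R)] (mod int p)"
proof (induction e arbitrary: R)
  case (Suc e)
  have "[ct ((A ^ (p ^ e)) ^ p * R) = ct (A ^ (p ^ e) * cartier p R)] (mod int p)"
    by (rule ct_power_prime_mult[OF assms])
  also have "[ct (A ^ (p ^ e) * cartier p R) = ct (A * cartier (p ^ e) (cartier p R))] (mod int p)"
    by (rule Suc)
  finally show ?case
    using prime_gt_0_nat[OF assms] by (simp add: cartier_cartier mult.commute flip: power_mult)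
qed simp

section \<open>Degree bounds\<close>

text \<open>A sup-norm bound, two-sided because exponents may be negative: products add it and
  \<open>cartier q\<close> divides it by \<open>q\<close>.\<close>

definition exps_le :: "int \<Rightarrow> ('r::finite) laurent_poly \<Rightarrow> bool" where
  "exps_le D R \<longleftrightarrow> (\<forall>v\<in>Poly_Mapping.keys R. \<forall>i. \<bar>v $ i\<bar> \<le> D)"

lemma exps_le_mono: "exps_le D R \<Longrightarrow> D \<le> E \<Longrightarrow> exps_le E R"
  unfolding exps_le_def by (meson order_trans)

lemma exps_le_exists: "\<exists>D. exps_le D R"
proof -
  have "finite ((\<lambda>(v, i). \<bar>v $ i\<bar>) ` (Poly_Mapping.keys R \<times> UNIV))" by simp
  then obtain D where "\<forall>x\<in>(\<lambda>(v, i). \<bar>v $ i\<bar>) ` (Poly_Mapping.keys R \<times> UNIV). x \<le> D"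
    using bdd_above_finite unfolding bdd_above_def by blast
  then show ?thesis by (auto simp: exps_le_def)
qed

lemma exps_le_mult:
  assumes "exps_le D A" "exps_le E B"
  shows "exps_le (D + E) (A * B)"
  unfolding exps_le_def
proof (intro ballI allI)
  fix v i assume "v \<in> Poly_Mapping.keys (A * B)"
  then obtain a b where "a \<in> Poly_Mapping.keys A" "b \<in> Poly_Mapping.keys B" "v = a + b"
    using keys_mult[of A B] by auto
  then show "\<bar>v $ i\<bar> \<le> D + E"
    using assms abs_triangle_ineq[of "a $ i" "b $ i"] unfolding exps_le_def
    by (metis add_mono order_trans vector_add_component)
qed

lemma exps_le_power: "exps_le D A \<Longrightarrow> exps_le (int n * D) (A ^ n)"
proof (induction n)
  case (Suc n)
  then show ?case using exps_le_mult[of D A "int n * D" "A ^ n"] by (simp add: distrib_right)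
qed (simp add: exps_le_def)

lemma exps_le_cartier:
  assumes "exps_le (int q * D) R" "q > 0"
  shows "exps_le D (cartier q R)"
  unfolding exps_le_def
proof (intro ballI allI)
  fix v i assume "v \<in> Poly_Mapping.keys (cartier q R)"
  then have "int q *s v \<in> Poly_Mapping.keys R"
    using assms(2) by (simp add: in_keys_iff lookup_cartier)
  then have "\<bar>(int q *s v) $ i\<bar> \<le> int q * D" using assms(1) unfolding exps_le_def by blast
  then show "\<bar>v $ i\<bar> \<le> D" using assms(2) by (simp add: abs_mult)
qed

text \<open>The only multiple of \<open>q\<close> in a box of radius below \<open>q\<close> is the
  zero vector.\<close>

lemma cartier_eq_const:
  assumes "exps_le D R" "D < int q" "q > 0"
  shows "cartier q R = Poly_Mapping.single 0 (ct R)"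
proof (rule poly_mapping_eqI)
  fix v
  show "Poly_Mapping.lookup (cartier q R) v = Poly_Mapping.lookup (Poly_Mapping.single 0 (ct R)) v"
  proof (cases "v = 0")
    case True
    then show ?thesis using assms(3) by (simp add: lookup_cartier ct_def)
  next
    case False
    then obtain i where "v $ i \<noteq> 0" by (auto simp: vec_eq_iff)
    then have "int q * 1 \<le> int q * \<bar>v $ i\<bar>" by (intro mult_left_mono) auto
    then have "\<not> \<bar>(int q *s v) $ i\<bar> \<le> D" using assms(2) by (simp add: abs_mult)
    then have "int q *s v \<notin> Poly_Mapping.keys R" using assms(1) unfolding exps_le_def by blast
    then show ?thesis
      using False assms(3) by (simp add: lookup_cartier in_keys_iff lookup_single)
  qed
qed

text \<open>In base \<open>p\<close> the block consists of \<open>m\<close> low zeros, then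
  \<open>n0\<close> padded to \<open>k\<close> digits. The zeros reduce the effect of the lower
  digits and of \<open>Q\<close> to a constant; the \<open>k\<close> digits split off the factor
  \<open>ct (P ^ n0)\<close>.\<close>

lemma ct_eq_0_if_digit_block:
  fixes P Q :: "('r::finite) laurent_poly"
  assumes p: "prime p" and n0: "[ct (P ^ n0) = 0] (mod int p)"
    and D: "exps_le D P" "exps_le D Q" "0 \<le> D" "D < int (p ^ m)" "int n0 * D < int (p ^ k)"
    and n: "n div (p ^ (m + k)) ^ a mod p ^ (m + k) = p ^ m * n0"
  shows "[ct (P ^ n * Q) = 0] (mod int p)"
proof -
  \<comment> \<open>\<open>q\<close> is the weight of the block; \<open>v\<close> collects the
    digits below it and \<open>u\<close> those above.\<close>
  define q where "q = p ^ ((m + k) * a)"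
  have pos: "p ^ e > 0" for e using prime_gt_0_nat[OF p] by simp
  have q: "q > 0" unfolding q_def by (rule pos)
  define u where "u = n div q div p ^ (m + k)"
  define v where "v = n mod q"
  have "n div q = p ^ m * n0 + p ^ (m + k) * u"
    using n mult_div_mod_eq[of "p ^ (m + k)" "n div q"]
    by (simp add: u_def q_def add.commute flip: power_mult)
  then have ndiv: "n div q = p ^ m * (n0 + p ^ k * u)"
    by (simp add: distrib_left power_add)
  have n_eq: "n = n div q * q + v" by (simp add: v_def)
  define R where "R = cartier q (P ^ v * Q)"
  have "[ct (P ^ n * Q) = ct ((P ^ (n div q)) ^ q * (P ^ v * Q))] (mod int p)"
    by (subst n_eq) (simp add: power_add mult.assoc flip: power_mult)
  also have "[ct ((P ^ (n div q)) ^ q * (P ^ v * Q)) = ct (P ^ (n div q) * R)] (mod int p)"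
    unfolding q_def R_def by (rule ct_prime_power_mult[OF p])
  also have "[ct (P ^ (n div q) * R)
      = ct (P ^ (n0 + p ^ k * u) * cartier (p ^ m) R)] (mod int p)"
    using ct_prime_power_mult[OF p, of "P ^ (n0 + p ^ k * u)" m R]
    by (simp add: ndiv mult.commute flip: power_mult)
  also have "cartier (p ^ m) R = Poly_Mapping.single 0 (ct R)"
  proof (rule cartier_eq_const[OF _ D(4) pos])
    \<comment> \<open>The product has exponents at most \<open>(v + 1) * D\<close>, hence at most
      \<open>q * D\<close>. So \<open>R\<close> again has bound \<open>D\<close>, whatever the
      position \<open>a\<close>.\<close>
    have "v + 1 \<le> q" using q by (simp add: v_def Suc_le_eq)
    then have "(int v + 1) * D \<le> int q * D" using D(3) by (intro mult_right_mono) auto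
    then have "exps_le (int q * D) (P ^ v * Q)"
      using exps_le_mono[OF exps_le_mult[OF exps_le_power[OF D(1)] D(2)]]
      by (simp add: distrib_right)
    then show "exps_le D R" unfolding R_def using q by (rule exps_le_cartier)
  qed
  also have "ct (P ^ (n0 + p ^ k * u) * Poly_Mapping.single 0 (ct R))
      = ct ((P ^ u) ^ (p ^ k) * P ^ n0) * ct R"
    unfolding ct_mult_const by (simp add: power_add mult.commute flip: power_mult)
  also have "[ct ((P ^ u) ^ (p ^ k) * P ^ n0) * ct R
      = ct (P ^ u * cartier (p ^ k) (P ^ n0)) * ct R] (mod int p)"
    by (intro cong_mult ct_prime_power_mult p cong_refl)
  also have "cartier (p ^ k) (P ^ n0) = Poly_Mapping.single 0 (ct (P ^ n0))"
    by (rule cartier_eq_const[OF exps_le_power[OF D(1)] D(5) pos])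
  also have "[ct (P ^ u * Poly_Mapping.single 0 (ct (P ^ n0))) * ct R = ct (P ^ u) * 0 * ct R] (mod int p)"
    unfolding ct_mult_const by (intro cong_mult n0 cong_refl)
  finally show ?thesis by simp
qed

section \<open>Density and recurrence\<close>

text \<open>Each stripped base-\<open>B\<close> digit has at most \<open>B - 1\<close> choices. The
  free factor \<open>M\<close> lets such intervals cover any \<open>N\<close> for fixed
  \<open>K\<close>.\<close>

lemma card_avoiding_digit:
  fixes S :: "nat set"
  assumes "w < B" and div: "\<And>n. n \<in> S \<Longrightarrow> n div B \<in> S" and mod: "\<And>n. n \<in> S \<Longrightarrow> n mod B \<noteq> w"
  shows "card (S \<inter> {0..<B ^ K * M}) \<le> (B - 1) ^ K * M"
proof (induction K)
  case 0
  show ?case using card_mono[of "{0..<M}" "S \<inter> {0..<M}"] by simp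
next
  case (Suc K)
  let ?f = "\<lambda>n. (n mod B, n div B)"
  let ?T = "({0..<B} - {w}) \<times> (S \<inter> {0..<B ^ K * M})"
  have "inj ?f" by (rule injI) (metis Pair_inject div_mod_decomp)
  moreover have "?f ` (S \<inter> {0..<B ^ Suc K * M}) \<subseteq> ?T"
    using assms by (auto simp: less_mult_imp_div_less ac_simps)
  ultimately have "card (S \<inter> {0..<B ^ Suc K * M}) \<le> card ?T"
    by (intro card_inj_on_le[of ?f]) (auto intro: inj_on_subset)
  also have "\<dots> = (B - 1) * card (S \<inter> {0..<B ^ K * M})"
    using assms(1) by (simp add: card_cartesian_product)
  also have "\<dots> \<le> (B - 1) * ((B - 1) ^ K * M)" by (intro mult_left_mono Suc) simp
  finally show ?case by (simp add: mult.assoc)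
qed

lemma has_density_Compl_avoiding_digit:
  fixes S :: "nat set"
  assumes "w < B" and div: "\<And>n. n \<in> S \<Longrightarrow> n div B \<in> S" and mod: "\<And>n. n \<in> S \<Longrightarrow> n mod B \<noteq> w"
  shows "has_density (- S) 1"
  unfolding has_density_def
proof (rule LIMSEQ_I)
  fix e :: real assume e: "e > 0"
  define r where "r = real (B - 1) / real B"
  have B: "B > 0" using assms(1) by simp
  have r: "0 \<le> r" "r < 1" using B by (auto simp: r_def)
  then obtain K where K: "r ^ K < e / 2"
    using e real_arch_pow_inv[of "e / 2" r] by auto
  have "norm (real (card (- S \<inter> {0..<N})) / real N - 1) < e" if N: "N \<ge> B ^ K" for N
  proof -
    have BK: "B ^ K > 0" using B by simp
    then have Npos: "N > 0" using N by (rule less_le_trans)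
    \<comment> \<open>Rounding up past \<open>N\<close> costs at most a factor 2 since
      \<open>N \<ge> B ^ K\<close>; this is why \<open>K\<close> was chosen with
      \<open>e / 2\<close>.\<close>
    let ?M = "N div B ^ K + 1"
    have "N \<le> B ^ K * ?M"
      using mult_div_mod_eq[of "B ^ K" N] mod_less_divisor[OF BK, of N]
      unfolding distrib_left by linarith
    then have "card (S \<inter> {0..<N}) \<le> card (S \<inter> {0..<B ^ K * ?M})" by (intro card_mono) auto
    also have "\<dots> \<le> (B - 1) ^ K * ?M" by (rule card_avoiding_digit[OF assms])
    finally have "real (card (S \<inter> {0..<N})) \<le> real ((B - 1) ^ K * ?M)" by linarith
    also have "\<dots> = r ^ K * (real B ^ K * real ?M)"
      using B by (simp add: r_def power_divide distrib_left)
    also have "real B ^ K * real ?M \<le> 2 * real N"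
    proof -
      have "B ^ K * ?M \<le> 2 * N"
        using N times_div_less_eq_dividend[of "B ^ K" N] unfolding distrib_left by linarith
      then show ?thesis by (metis of_nat_le_iff of_nat_mult of_nat_numeral of_nat_power)
    qed
    then have "r ^ K * (real B ^ K * real ?M) \<le> r ^ K * (2 * real N)"
      using r by (intro mult_left_mono) auto
    also have "\<dots> < e * real N" using K Npos by simp
    finally have less: "real (card (S \<inter> {0..<N})) < e * real N" .
    have "card (S \<inter> {0..<N}) + card (- S \<inter> {0..<N}) = card ((S \<inter> {0..<N}) \<union> (- S \<inter> {0..<N}))"
      by (intro card_Un_disjoint[symmetric]) auto
    also have "(S \<inter> {0..<N}) \<union> (- S \<inter> {0..<N}) = {0..<N}" by auto
    finally have "real (card (- S \<inter> {0..<N})) = real N - real (card (S \<inter> {0..<N}))"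
      by simp
    then have "real (card (- S \<inter> {0..<N})) / real N - 1 = - (real (card (S \<inter> {0..<N})) / real N)"
      using Npos by (simp add: diff_divide_distrib)
    then show ?thesis using less Npos by (simp add: divide_less_eq)
  qed
  then show "\<exists>N0. \<forall>N\<ge>N0. norm (real (card (- S \<inter> {0..<N})) / real N - 1) < e" by blast
qed

lemma has_density_1_mono:
  assumes "has_density S 1" "S \<subseteq> T"
  shows "has_density T 1"
  unfolding has_density_def
proof (rule tendsto_sandwich[OF _ _ _ tendsto_const])
  show "(\<lambda>N. real (card (S \<inter> {0..<N})) / real N) \<longlonglongrightarrow> 1"
    using assms(1) by (simp add: has_density_def)
  show "\<forall>\<^sub>F N in sequentially. real (card (S \<inter> {0..<N})) / real N \<le> real (card (T \<inter> {0..<N})) / real N"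
    using assms(2) by (intro always_eventually allI divide_right_mono) (auto intro!: card_mono)
  show "\<forall>\<^sub>F N in sequentially. real (card (T \<inter> {0..<N})) / real N \<le> 1"
  proof (intro always_eventually allI)
    fix N
    have "card (T \<inter> {0..<N}) \<le> N" using card_mono[of "{0..<N}" "T \<inter> {0..<N}"] by simp
    then show "real (card (T \<inter> {0..<N})) / real N \<le> 1" by (cases "N = 0") (simp_all add: divide_le_eq_1)
  qed
qed

text \<open>The value \<open>s n\<close> must return with gaps at most \<open>C\<close>, so it
  cannot jump over a run of \<open>a\<close> longer than \<open>C\<close>.\<close>

lemma uniformly_recurrent_long_runs_const:
  assumes "uniformly_recurrent s" and runs: "has_arbitrarily_long_runs s a"
  shows "s n = a"
proof -
  have occ: "occurs_at s [s n] i \<longleftrightarrow> s i = s n" for i by (simp add: occurs_at_def)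
  then obtain C where C: "\<And>i. s i = s n \<Longrightarrow> \<exists>j. i < j \<and> j \<le> i + C \<and> s j = s n"
    using assms(1) unfolding uniformly_recurrent_def by metis
  obtain i where "occurs_at s (replicate (n + C + 1) a) i"
    using runs unfolding has_arbitrarily_long_runs_def by blast
  then have run: "s (i + j) = a" if "j \<le> n + C" for j
    using that by (auto simp: occurs_at_def simp del: replicate_Suc)
  \<comment> \<open>The cutoff \<open>i + n\<close> rather than \<open>i\<close> guarantees
    \<open>n\<close> is in \<open>A\<close>; the run is long enough to contain the next
    \<open>C\<close> positions.\<close>
  define A where "A = {j. j \<le> i + n \<and> s j = s n}"
  have A: "finite A" "n \<in> A" by (auto simp: A_def)
  then have "Max A \<in> A" by (intro Max_in) auto
  then obtain k where k: "Max A < k" "k \<le> Max A + C" "s k = s n"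
    using C by (auto simp: A_def)
  have "k \<notin> A" using Max_ge[OF A(1), of k] k(1) by auto
  then have "i + n < k" using k(3) by (auto simp: A_def)
  moreover have "k \<le> i + n + C" using k(2) \<open>Max A \<in> A\<close> by (simp add: A_def)
  ultimately have "s k = a" using run[of "k - i"] by simp
  then show ?thesis using k(3) by simp
qed

text \<open>Non-recurrence is claimed only if some term is nonzero: the zero sequence, as for
  \<open>Q = 0\<close>, is uniformly recurrent.\<close>

theorem theorem14:
  fixes P :: "('r::finite) laurent_poly" and p :: nat
  assumes "prime p"
    and "\<exists>n::nat. [ct (P ^ n) = 0] (mod int p)"
  shows "\<forall>Q :: 'r laurent_poly.
    has_density {n::nat. [ct (P ^ n * Q) = 0] (mod int p)} 1 \<and>
    has_arbitrarily_long_runs (\<lambda>n::nat. ct (P ^ n * Q) mod int p) 0 \<and>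
    ((\<exists>n::nat. \<not> [ct (P ^ n * Q) = 0] (mod int p)) \<longrightarrow>
      \<not> uniformly_recurrent (\<lambda>n::nat. ct (P ^ n * Q) mod int p))"
proof
  fix Q :: "'r laurent_poly"
  obtain n0 where n0: "[ct (P ^ n0) = 0] (mod int p)" using assms(2) by blast
  have p: "p > 1" using assms(1) prime_gt_1_nat by simp
  have n0_pos: "n0 > 0"
  proof (rule ccontr)
    assume "\<not> n0 > 0"
    then have "[1 = 0] (mod int p)" using n0 by (simp add: ct_def flip: single_one)
    then show False using p by (simp add: cong_def)
  qed
  obtain D1 D2 where "exps_le D1 P" "exps_le D2 Q" using exps_le_exists by metis
  \<comment> \<open>\<open>D \<ge> 1\<close> ensures that \<open>n0 * D < p ^ k\<close> gives
    \<open>n0 < p ^ k\<close>, so that \<open>w\<close> is a base-\<open>B\<close> digit.\<close>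
  moreover define D where "D = max 1 (max D1 D2)"
  ultimately have D: "exps_le D P" "exps_le D Q" "D \<ge> 1"
    by (auto elim!: exps_le_mono)
  have exceed: "\<exists>e. x < int (p ^ e)" for x
  proof -
    have "nat x < p ^ nat x" using p by (intro power_gt_expt) simp
    then show ?thesis by (intro exI[of _ "nat x"]) linarith
  qed
  obtain m where m: "D < int (p ^ m)" using exceed by blast
  obtain k where k: "int n0 * D < int (p ^ k)" using exceed by blast
  define B where "B = p ^ (m + k)"
  define w where "w = p ^ m * n0"
  have "int n0 * 1 \<le> int n0 * D" using D(3) by (intro mult_left_mono) auto
  then have "n0 < p ^ k" using k by linarith
  then have wB: "w < B" using p by (simp add: w_def B_def power_add)
  have w_pos: "w > 0" using n0_pos p by (simp add: w_def)
  have zero: "[ct (P ^ n * Q) = 0] (mod int p)" if "n div B ^ a mod B = w" for n a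
    using ct_eq_0_if_digit_block[OF assms(1) n0 D(1,2) _ m k] that D(3) by (simp add: B_def w_def)
  define S where "S = {n. \<forall>a. n div B ^ a mod B \<noteq> w}"
  have "has_density (- S) 1"
  proof (rule has_density_Compl_avoiding_digit[OF wB])
    fix n assume n: "n \<in> S"
    show "n div B \<in> S"
      unfolding S_def
    proof (intro CollectI allI)
      fix a
      show "n div B div B ^ a mod B \<noteq> w"
        using n by (auto simp: S_def div_mult2_eq dest: spec[of _ "Suc a"])
    qed
    show "n mod B \<noteq> w" using n by (auto simp: S_def dest: spec[of _ 0])
  qed
  then have dens: "has_density {n. [ct (P ^ n * Q) = 0] (mod int p)} 1"
    by (rule has_density_1_mono) (auto simp: S_def zero)
  have runs: "has_arbitrarily_long_runs (\<lambda>n. ct (P ^ n * Q) mod int p) 0"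
    unfolding has_arbitrarily_long_runs_def
  proof
    fix L
    \<comment> \<open>Adding any \<open>j < B ^ L\<close> to \<open>B ^ L * w\<close> keeps the
      digit \<open>w\<close> at position \<open>L\<close>, and \<open>L < B ^ L\<close>.\<close>
    have "occurs_at (\<lambda>n. ct (P ^ n * Q) mod int p) (replicate L 0) (B ^ L * w)"
      unfolding occurs_at_def
    proof (intro allI impI)
      fix j assume j: "j < length (replicate L (0::int))"
      have "B > 1" using wB w_pos by simp
      then have "j < B ^ L" using j power_gt_expt[of B L] by simp
      then have "(B ^ L * w + j) div B ^ L mod B = w" using wB by simp
      then show "ct (P ^ (B ^ L * w + j) * Q) mod int p = replicate L 0 ! j"
        using zero j by (simp add: cong_def)
    qed
    then show "\<exists>i. occurs_at (\<lambda>n. ct (P ^ n * Q) mod int p) (replicate L 0) i" ..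
  qed
  have "\<not> uniformly_recurrent (\<lambda>n. ct (P ^ n * Q) mod int p)"
    if "\<exists>n. \<not> [ct (P ^ n * Q) = 0] (mod int p)"
    using uniformly_recurrent_long_runs_const[OF _ runs] that by (auto simp: cong_def)
  then show "has_density {n. [ct (P ^ n * Q) = 0] (mod int p)} 1 \<and>
    has_arbitrarily_long_runs (\<lambda>n. ct (P ^ n * Q) mod int p) 0 \<and>
    ((\<exists>n. \<not> [ct (P ^ n * Q) = 0] (mod int p)) \<longrightarrow>
      \<not> uniformly_recurrent (\<lambda>n. ct (P ^ n * Q) mod int p))"
    using dens runs by blast
qed

end
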